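(* For every integer $r\geq 3$, the set $$\{s\in\mathbb N : s\equiv 3\pmod 4,\ \ell(s)=r\}$$ is the union of exactly $F_r-1$ residue classes modulo $2^{r+2}$.
   Context: $\mathbb N$ denotes the positive integers. The Collatz function $T:\mathbb N\to\mathbb N$ is $T(n)=n/2$ if $n$ is even and $T(n)=(3n+1)/2$ if $n$ is odd; $T^0(s)=s$ and $T^k(s)=T(T^{k-1}(s))$ for $k\geq1$. For odd $s\in\mathbb N$, the cut time is $$\ell(s)=\min\{k\geq1 : T^k(s)\equiv 3\pmod 4 \text{ and } T^{k-1}(s)\text{ is even}\},$$ with $\ell(s)=\infty$ if this set is empty. A residue class modulo $m$ means a set $[a]_m=\{n\in\mathbb N: n\equiv a\pmod m\}$. The Fibonacci numbers are $F_0=0$, $F_1=1$, $F_{m+1}=F_m+F_{m-1}$ for $m\geq1$. *)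

theory Defs
  imports "HOL-Number_Theory.Number_Theory" "HOL-Library.Extended_Nat"
begin

text \<open>The positive integers are the positive elements of \<^typ>\<open>nat\<close>. The map below
  additionally sends 0 to 0 and preserves positivity.\<close>

definition collatz :: "nat \<Rightarrow> nat" where
  "collatz n = (if even n then n div 2 else (3 * n + 1) div 2)"

definition cut_times :: "nat \<Rightarrow> nat set" where
  "cut_times s = {k. k \<ge> 1 \<and> [(collatz ^^ k) s = 3] (mod 4) \<and> even ((collatz ^^ (k - 1)) s)}"

text \<open>Meaningful for odd positive \<open>s\<close> only.\<close>

definition cut_time :: "nat \<Rightarrow> enat" where
  "cut_time s = (if cut_times s = {} then \<infinity> else enat (LEAST k. k \<in> cut_times s))"

definition residue_class :: "nat \<Rightarrow> nat \<Rightarrow> nat set" where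
  "residue_class m a = {n. n > 0 \<and> [n = a] (mod m)}"

definition residue_classes :: "nat \<Rightarrow> nat set set" where
  "residue_classes m = range (residue_class m)"

end

theory Submission
  imports Defs
begin

text \<open>The residue of \<open>s\<close> modulo \<open>2 ^ n\<close> and the parities of \<open>s, T s, \<dots>, T\<^sup>n\<^sup>-\<^sup>1 s\<close> determine
  each other, and every parity word occurs (Terras). In terms of parities, \<open>s \<equiv> 3 (mod 4)\<close> says
  that the word begins with 11, and a cut at time \<open>k\<close> is an occurrence of 011 at position \<open>k - 1\<close>.
  So the residue classes are counted by the words \<open>11v\<close> of length \<open>r + 2\<close> whose first occurrence of
  011 is at the very end. Prepending a letter to such a word \<open>v\<close> of length \<open>n + 3\<close> gives another
  one, unless the letter is 0 and \<open>v\<close> begins with 11; hence the numbers \<open>l n\<close> of such words satisfy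
  \<open>l (n + 3) = 2 l (n + 2) - l n\<close>, the recurrence of \<open>fib (n + 3) - 1\<close>.\<close>

definition parity_word :: "nat \<Rightarrow> nat \<Rightarrow> bool list" where
  "parity_word n s = map (\<lambda>i. odd ((collatz ^^ i) s)) [0..<n]"

lemma length_parity_word [simp]: "length (parity_word n s) = n"
  by (simp add: parity_word_def)

lemma nth_parity_word [simp]: "i < n \<Longrightarrow> parity_word n s ! i \<longleftrightarrow> odd ((collatz ^^ i) s)"
  by (simp add: parity_word_def)

lemma parity_word_Suc: "parity_word (Suc n) s = odd s # parity_word n (collatz s)"
  by (simp add: parity_word_def map_upt_Suc funpow_swap1 del: upt_Suc)

lemma collatz_double [simp]: "collatz (2 * a) = a"
  by (simp add: collatz_def)

lemma collatz_double_Suc [simp]: "collatz (Suc (2 * a)) = 3 * a + 2"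
  by (simp add: collatz_def)

lemma cong_double_iff:
  fixes a b m :: nat
  shows "[2 * a = 2 * b] (mod 2 * m) \<longleftrightarrow> [a = b] (mod m)"
  by (simp add: cong_def flip: mult_mod_right)

text \<open>On either parity \<open>collatz\<close> is affine, taking 2a to a and 2a + 1 to 3a + 2.
  Since 3 is invertible modulo 2 ^ n, each application costs exactly one binary digit of
  precision.\<close>

lemma cong_two_power_Suc_iff:
  fixes s t :: nat
  shows "[s = t] (mod 2 ^ Suc n) \<longleftrightarrow>
    (even s \<longleftrightarrow> even t) \<and> [collatz s = collatz t] (mod 2 ^ n)"
proof (cases "even s \<longleftrightarrow> even t")
  case False
  then have "\<not> [s = t] (mod 2 ^ Suc n)"
    by (metis cong_dvd_iff dvd_triv_left power_Suc cong_dvd_modulus_nat)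
  with False show ?thesis by simp
next
  case same: True
  show ?thesis
  proof (cases "even s")
    case True
    with same obtain a b where "s = 2 * a" "t = 2 * b" by (metis evenE)
    then show ?thesis by (simp add: cong_double_iff)
  next
    case False
    with same obtain a b where st: "s = Suc (2 * a)" "t = Suc (2 * b)"
      by (metis oddE Suc_eq_plus1)
    have "[s = t] (mod 2 ^ Suc n) \<longleftrightarrow> [a = b] (mod 2 ^ n)"
      using cong_add_rcancel_nat[of "2 * a" 1 "2 * b" "2 * 2 ^ n"]
      by (simp add: st cong_double_iff)
    moreover have "[collatz s = collatz t] (mod 2 ^ n) \<longleftrightarrow> [a = b] (mod 2 ^ n)"
      using cong_add_rcancel_nat[of "3 * a" 2 "3 * b" "2 ^ n"]
        cong_mult_lcancel_nat[of 3 "2 ^ n" a b]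
      by (simp add: st)
    ultimately show ?thesis using same by blast
  qed
qed

lemma parity_word_eq_iff: "parity_word n s = parity_word n t \<longleftrightarrow> [s = t] (mod 2 ^ n)"
proof (induction n arbitrary: s t)
  case 0
  show ?case by (simp add: parity_word_def)
next
  case (Suc n)
  then show ?case
    unfolding cong_two_power_Suc_iff by (auto simp: parity_word_Suc)
qed

text \<open>Injectivity suffices: there are as many words as residues.\<close>

lemma bij_betw_parity_word: "bij_betw (parity_word n) {..<2 ^ n} {w. length w = n}"
proof -
  have inj: "inj_on (parity_word n) {..<2 ^ n}"
    by (auto intro!: inj_onI simp: parity_word_eq_iff cong_def)
  have fin: "finite {w :: bool list. length w = n}"
    and card: "card {w :: bool list. length w = n} = 2 ^ n"
    using finite_lists_length_eq[of "UNIV :: bool set" n] card_lists_length_eq[of "UNIV :: bool set" n]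
    by simp_all
  have "parity_word n ` {..<2 ^ n} = {w. length w = n}"
    by (rule card_subset_eq[OF fin]) (auto simp: card card_image[OF inj])
  with inj show ?thesis by (simp add: bij_betw_def)
qed

lemma inj_on_residue_class: "inj_on (residue_class m) {..<m}"
proof (rule inj_onI)
  fix a b assume ab: "a \<in> {..<m}" "b \<in> {..<m}" "residue_class m a = residue_class m b"
  \<comment> \<open>The representative a itself may be 0, which lies in no class.\<close>
  have "a + m \<in> residue_class m a"
    using ab(1) by (simp add: residue_class_def cong_def)
  then have "[a = b] (mod m)"
    unfolding ab(3) by (simp add: residue_class_def cong_def)
  with ab show "a = b" by (simp add: cong_def)
qed

text \<open>Turns counting residue classes into counting words.\<close>

lemma parity_word_set_residue_classes:
  assumes W: "W \<subseteq> {w. length w = n}"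
  shows "\<exists>\<C>. \<C> \<subseteq> residue_classes (2 ^ n) \<and> finite \<C> \<and> card \<C> = card W \<and>
    {s. s > 0 \<and> parity_word n s \<in> W} = \<Union> \<C>"
proof -
  define A where "A = {a \<in> {..<2 ^ n}. parity_word n a \<in> W}"
  define \<C> where "\<C> = residue_class (2 ^ n) ` A"
  have "A \<subseteq> {..<2 ^ n}" by (auto simp: A_def)
  then have "card \<C> = card A"
    unfolding \<C>_def by (intro card_image inj_on_subset[OF inj_on_residue_class])
  also have "parity_word n ` A = W"
    using W unfolding bij_betw_imp_surj_on[OF bij_betw_parity_word, symmetric]
    by (auto simp: A_def)
  then have "card A = card W"
    using card_image[OF inj_on_subset[OF bij_betw_imp_inj_on[OF bij_betw_parity_word] \<open>A \<subseteq> _\<close>]]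
    by simp
  finally have "card \<C> = card W" .
  moreover have "{s. s > 0 \<and> parity_word n s \<in> W} = \<Union> \<C>"
  proof (intro Set.set_eqI iffI)
    fix s assume s: "s \<in> {s. s > 0 \<and> parity_word n s \<in> W}"
    have "parity_word n (s mod 2 ^ n) = parity_word n s"
      by (simp add: parity_word_eq_iff)
    with s have "s mod 2 ^ n \<in> A" by (simp add: A_def)
    moreover have "s \<in> residue_class (2 ^ n) (s mod 2 ^ n)"
      using s by (simp add: residue_class_def cong_def)
    ultimately show "s \<in> \<Union> \<C>" by (auto simp: \<C>_def)
  next
    fix s assume "s \<in> \<Union> \<C>"
    then show "s \<in> {s. s > 0 \<and> parity_word n s \<in> W}"
      by (auto simp: \<C>_def A_def residue_class_def simp flip: parity_word_eq_iff)
  qed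
  ultimately show ?thesis
    by (intro exI[of _ \<C>]) (auto simp: \<C>_def A_def residue_classes_def)
qed

text \<open>Stated for a function so that it covers both finite words, through \<open>nth\<close>,
  and the infinite parity sequence of an orbit.\<close>

definition cut_at :: "(nat \<Rightarrow> bool) \<Rightarrow> nat \<Rightarrow> bool" where
  "cut_at p i \<longleftrightarrow> \<not> p i \<and> p (Suc i) \<and> p (Suc (Suc i))"

definition first_cut_words :: "nat \<Rightarrow> bool list set" where
  "first_cut_words n =
    {w. length w = n + 3 \<and> cut_at (nth w) n \<and> (\<forall>i<n. \<not> cut_at (nth w) i)}"

lemma finite_first_cut_words: "finite (first_cut_words n)"
  using finite_lists_length_eq[of "UNIV :: bool set" "n + 3"]
  by (rule rev_finite_subset) (auto simp: first_cut_words_def)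

lemma first_cut_words_0: "first_cut_words 0 = {[False, True, True]}"
  by (auto simp: first_cut_words_def cut_at_def length_Suc_conv numeral_3_eq_3)

lemma cut_at_Cons_Suc [simp]: "cut_at ((!) (x # v)) (Suc i) \<longleftrightarrow> cut_at ((!) v) i"
  by (simp add: cut_at_def)

text \<open>Old positions shift by one, so the only new constraint is that no 011 arises at position
  0.\<close>

lemma Cons_in_first_cut_words_Suc:
  "x # v \<in> first_cut_words (Suc n) \<longleftrightarrow>
    v \<in> first_cut_words n \<and> (x \<or> \<not> (v ! 0 \<and> v ! 1))"
  by (auto simp: first_cut_words_def All_less_Suc2) (auto simp: cut_at_def)

lemma first_cut_words_Suc:
  "first_cut_words (Suc n) = Cons True ` first_cut_words n \<union>
    Cons False ` {v \<in> first_cut_words n. \<not> (v ! 0 \<and> v ! 1)}" (is "?L = ?R")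
proof (rule Set.set_eqI)
  fix w
  show "w \<in> ?L \<longleftrightarrow> w \<in> ?R"
  proof (cases w)
    case Nil
    then show ?thesis by (auto simp: first_cut_words_def)
  next
    case (Cons x v)
    then show ?thesis by (cases x) (auto simp: Cons_in_first_cut_words_Suc)
  qed
qed

text \<open>A prepended 1 never starts an occurrence of 011, so a leading 11 can be added or removed
  freely. This gives both the subtracted term of the recurrence and the final count.\<close>

lemma first_cut_words_prefix_11:
  "{v \<in> first_cut_words (n + 2). v ! 0 \<and> v ! 1} =
    (\<lambda>v. True # True # v) ` first_cut_words n"
  by (auto simp: first_cut_words_Suc)

lemma card_first_cut_words_Suc:
  "card (first_cut_words (Suc n)) + card {v \<in> first_cut_words n. v ! 0 \<and> v ! 1} =
    2 * card (first_cut_words n)"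
proof -
  let ?B = "{v \<in> first_cut_words n. v ! 0 \<and> v ! 1}"
  let ?G = "{v \<in> first_cut_words n. \<not> (v ! 0 \<and> v ! 1)}"
  have "card (first_cut_words (Suc n)) = card (first_cut_words n) + card ?G"
    unfolding first_cut_words_Suc
    by (subst card_Un_disjoint) (auto simp: finite_first_cut_words card_image)
  moreover have "card ?B + card ?G = card (?B \<union> ?G)"
    by (rule card_Un_disjoint[symmetric]) (auto simp: finite_first_cut_words)
  moreover have "?B \<union> ?G = first_cut_words n" by auto
  ultimately show ?thesis by simp
qed

lemma card_first_cut_words: "card (first_cut_words n) + 1 = fib (n + 3)"
proof (induction n rule: less_induct)
  case (less n)
  have l0: "card (first_cut_words 0) = 1" by (simp add: first_cut_words_0)
  have "{v \<in> first_cut_words 0. v ! 0 \<and> v ! 1} = {}"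
    by (auto simp: first_cut_words_0)
  with card_first_cut_words_Suc[of 0] l0 have l1: "card (first_cut_words 1) = 2"
    by (simp only: card.empty One_nat_def)
  have "{v \<in> first_cut_words 1. v ! 0 \<and> v ! 1} = {}"
    by (auto simp: first_cut_words_0 first_cut_words_Suc)
  with card_first_cut_words_Suc[of 1] l1 have l2: "card (first_cut_words 2) = 4"
    by (simp only: card.empty flip: Suc_1) simp
  \<comment> \<open>Stripping a leading 11 lowers the index by two and the recurrence adds one more
    step, hence three base cases.\<close>
  consider "n = 0" | "n = 1" | "n = 2" | m where "n = m + 3"
    by (metis One_nat_def Suc_1 add.commute less_2_cases le_Suc_ex not_less numeral_3_eq_3 less_Suc_eq)
  then show ?case
  proof cases
    case 4
    have "card {v \<in> first_cut_words (m + 2). v ! 0 \<and> v ! 1} = card (first_cut_words m)"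
      unfolding first_cut_words_prefix_11 by (intro card_image inj_onI) simp
    with card_first_cut_words_Suc[of "m + 2"]
    have "card (first_cut_words (m + 3)) + card (first_cut_words m) =
        2 * card (first_cut_words (m + 2))"
      by (simp add: numeral_3_eq_3)
    moreover have "card (first_cut_words m) + 1 = fib (m + 3)"
      and "card (first_cut_words (m + 2)) + 1 = fib (m + 5)"
      using less[of m] less[of "m + 2"] 4 by (simp_all add: eval_nat_numeral)
    \<comment> \<open>Expand fib (m + 6) as fib (m + 5) + fib (m + 4), then merge fib (m + 4) with
      fib (m + 3).\<close>
    moreover have "fib (m + 6) + fib (m + 3) = 2 * fib (m + 5)"
      by (simp add: eval_nat_numeral)
    ultimately show ?thesis using 4 by (simp add: add.commute)
  qed (use l0 l1 l2 in \<open>simp_all add: eval_nat_numeral\<close>)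
qed

text \<open>The case of words of length 2: both 3 and T 3 = 5 are odd.\<close>

lemma cong_3_mod_4_iff: "[n = 3] (mod 4) \<longleftrightarrow> odd n \<and> odd (collatz n)"
proof -
  have "[n = 3] (mod 4) \<longleftrightarrow> parity_word 2 n = parity_word 2 3"
    by (simp add: parity_word_eq_iff)
  moreover have "parity_word 2 m = [odd m, odd (collatz m)]" for m
    by (simp add: parity_word_def upt_rec)
  moreover have "odd (collatz 3)" by (simp add: collatz_def)
  ultimately show ?thesis by simp
qed

lemma Suc_in_cut_times_iff: "Suc i \<in> cut_times s \<longleftrightarrow> cut_at (\<lambda>i. odd ((collatz ^^ i) s)) i"
  by (auto simp: cut_times_def cut_at_def cong_3_mod_4_iff)

lemma cut_time_eq_enat_iff:
  "cut_time s = enat k \<longleftrightarrow> k \<in> cut_times s \<and> (\<forall>i<k. i \<notin> cut_times s)"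
proof
  assume "cut_time s = enat k"
  then have "cut_times s \<noteq> {}" and k: "k = (LEAST k. k \<in> cut_times s)"
    by (auto simp: cut_time_def split: if_splits)
  then show "k \<in> cut_times s \<and> (\<forall>i<k. i \<notin> cut_times s)"
    by (metis LeastI ex_in_conv not_less_Least)
next
  assume k: "k \<in> cut_times s \<and> (\<forall>i<k. i \<notin> cut_times s)"
  then have "(LEAST k. k \<in> cut_times s) = k"
    by (intro Least_equality) (auto simp: not_less[symmetric])
  with k show "cut_time s = enat k" by (auto simp: cut_time_def)
qed

lemma cut_time_Suc_iff:
  "cut_time s = enat (Suc n) \<longleftrightarrow> parity_word (n + 3) s \<in> first_cut_words n"
proof -
  \<comment> \<open>Time \<open>Suc i\<close> corresponds to position \<open>i\<close>, which leaves
    time 0 to be excluded separately.\<close>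
  have "0 \<notin> cut_times s" by (simp add: cut_times_def)
  then have "cut_time s = enat (Suc n) \<longleftrightarrow>
      cut_at (\<lambda>i. odd ((collatz ^^ i) s)) n \<and> (\<forall>i<n. \<not> cut_at (\<lambda>i. odd ((collatz ^^ i) s)) i)"
    by (simp add: cut_time_eq_enat_iff All_less_Suc2 Suc_in_cut_times_iff)
  \<comment> \<open>A cut at \<open>i \<le> n\<close> reads positions up to \<open>n + 2\<close>
    only, so a prefix of length \<open>n + 3\<close> decides it.\<close>
  moreover have "cut_at (\<lambda>i. odd ((collatz ^^ i) s)) i \<longleftrightarrow> cut_at ((!) (parity_word (n + 3) s)) i"
    if "i \<le> n" for i
    using that by (simp add: cut_at_def)
  ultimately show ?thesis by (auto simp: first_cut_words_def)
qed

theorem theorem1p2: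
  fixes r :: nat
  assumes "r \<ge> 3"
  shows "\<exists>\<C>. \<C> \<subseteq> residue_classes (2 ^ (r + 2)) \<and> finite \<C> \<and> card \<C> = fib r - 1 \<and>
    {s. s > 0 \<and> [s = 3] (mod 4) \<and> cut_time s = enat r} = \<Union> \<C>"
proof -
  obtain n where r: "r = n + 3" using assms by (metis le_Suc_ex add.commute)
  \<comment> \<open>Cut time \<open>r = Suc (n + 2)\<close> means index \<open>n + 2\<close>, that
    is, words of length \<open>n + 5 = r + 2\<close>; removing the leading 11 leaves index
    \<open>n\<close>.\<close>
  define W where "W = {w \<in> first_cut_words (n + 2). w ! 0 \<and> w ! 1}"
  have "card W = card (first_cut_words n)"
    unfolding W_def first_cut_words_prefix_11 by (intro card_image inj_onI) simp
  then have "card W = fib r - 1"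
    using card_first_cut_words[of n] by (simp add: r)
  moreover have "[s = 3] (mod 4) \<and> cut_time s = enat r \<longleftrightarrow> parity_word (r + 2) s \<in> W" for s
    using cut_time_Suc_iff[of s "n + 2"] unfolding cong_3_mod_4_iff
    by (auto simp: W_def r add.commute)
  moreover have "W \<subseteq> {w. length w = r + 2}"
    by (auto simp: W_def first_cut_words_def r)
  ultimately show ?thesis
    using parity_word_set_residue_classes[of W "r + 2"] by simp
qed

end
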